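(* Let $X$ and $Y$ be two Banach spaces. Then: 1. For any two sequences $(A_n)_{n\in\mathbb N'}$ and $(B_n)_{n\in\mathbb N'}$ from $\mathcal C(X,Y)$, $\lambda_{\mathbb N'}[A_n,B_n]\le\varlimsup_{n\in\mathbb N'}\delta(A_n,B_n)$. 2. If $A\in\mathcal C(X,Y)$ and $(C_n)_{n\in\mathbb N'}$ is a sequence from $\mathcal B(X,Y)$ with $\lim_{n\in\mathbb N'}\|C_n\|=0$, then $\lambda_{\mathbb N'}[A+C_n,A]=\lambda_{\mathbb N'}[A,A+C_n]=0$. 3. If $A,C\in\mathcal C(X,Y)$ and $C$ is $A$-compact, then $\lambda[A,A+C]=0$. 4. If $A\in\mathcal C(X,Y)$ and $C\in\mathcal B(X,Y)$, then $\lambda[A,A+C]\le\|C\|_q$. 5. If $A\in\mathcal C(X,Y)$ and $C\in\mathcal K(X,Y)$, then $\lambda[A,A+C]=\lambda[A+C,A]=0$. 6. If $A\in\mathcal C(X,Y)$, $(C_n)_{n\in\mathbb N'}\subset\mathcal B(X,Y)$, and $(C_n)_{\mathbb N'}$ $K_2$-approximates the null operator, then $\lambda_{\mathbb N'}[A+C_n,A]=\lambda_{\mathbb N'}[A,A+C_n]=0$.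
   Context: $\mathbb N'$ denotes an infinite subset of $\mathbb N$. $\mathcal C(X,Y)$: closed linear operators from $X$ to $Y$ (closed graph; domain possibly a proper subspace of $X$). $\mathcal B(X,Y)$: bounded operators defined on all of $X$. $\mathcal K(X,Y)$: compact operators in $\mathcal B(X,Y)$. $X\times Y$ has norm $\max\{\|x\|,\|y\|\}$; $G_A$ is the graph of $A$. Gap: for closed subspaces $M\neq\{\theta\}$ and $P$, $\delta(M,P)=\sup\{dist(x,P):x\in M,\|x\|=1\}$; for operators $\delta(A,B)=\delta(G_A,G_B)$. $C$ is $A$-compact if $\{Cx_n\}$ is relatively compact in $Y$ for every sequence $(x_n)$ such that $(x_n,Ax_n)$ is bounded in $X\times Y$ (in particular $C$ is defined on $dom(A)$). Hausdorff measure of noncompactness of a bounded set $M$: $q(M)=\inf\{e: M$ is covered by finitely many balls of radius $e\}$; $q$-norm of $C\in\mathcal B(X,Y)$: $\|C\|_q=q(C(S))$, $S$ the unit ball of $X$. A sequence $(C_n)_{\mathbb N'}$ of continuous operators $K_2$-approximates the null operator if for every bounded sequence $(x_n)_{\mathbb N'}$ with $x_n\in dom(C_n)$ the sequence $(C_nx_n)_{\mathbb N'}$ is relatively compact in $Y$. Uniform $\lambda$-adjustment: a sequence $(M_n)_{\mathbb N'}$ of nonzero closed subspaces of a Banach space $Z$ is lower uniformly $\lambda$-adjusted ($\lambda\ge0$) with a sequence $(P_n)_{\mathbb N'}$ of closed subspaces if for every $\eta>0$, every infinite $\mathbb N''\subset\mathbb N'$ and every sequence of unit vectors $x_n\in M_n$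 ($n\in\mathbb N''$) there exist an infinite $\mathbb N'''\subset\mathbb N''$, $y_n\in P_n$ ($n\in\mathbb N'''$) and $z\in Z$ with $\varlimsup_{n\in\mathbb N'''}\|x_n-y_n-z\|\le\lambda+\eta$; $\lambda_{\mathbb N'}[M_n,P_n]$ is the infimum of such $\lambda$. For operators, $\lambda_{\mathbb N'}[A_n,B_n]=\lambda_{\mathbb N'}[G_{A_n},G_{B_n}]$ in $X\times Y$; a single operator is regarded as a constant sequence, and $\lambda[A,B]$ denotes $\lambda_{\mathbb N'}[A_n,B_n]$ for the constant sequences $A_n=A$, $B_n=B$. *)

theory Defs
  imports "HOL-Analysis.Analysis"
begin

text \<open>The library norm on \<open>'a \<times> 'b\<close> is the Euclidean one. The gap and the adjustment
  constant depend on the norm, so the product with the maximum norm is a separate type.\<close>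

datatype ('a, 'b) max_prod = MaxPair (mfst: 'a) (msnd: 'b)

instantiation max_prod :: (real_vector, real_vector) real_vector
begin

definition "0 = MaxPair 0 0"
definition "z + w = MaxPair (mfst z + mfst w) (msnd z + msnd w)"
definition "z - w = MaxPair (mfst z - mfst w) (msnd z - msnd w)"
definition "- z = MaxPair (- mfst z) (- msnd z)"
definition "r *\<^sub>R z = MaxPair (r *\<^sub>R mfst z) (r *\<^sub>R msnd z)"

instance
  by standard
    (auto simp: zero_max_prod_def plus_max_prod_def minus_max_prod_def uminus_max_prod_def
      scaleR_max_prod_def algebra_simps intro: max_prod.expand)

end

lemma max_prod_sel [simp]:
  "mfst 0 = 0" "msnd 0 = 0"
  "mfst (z + w) = mfst z + mfst w" "msnd (z + w) = msnd z + msnd w"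
  "mfst (z - w) = mfst z - mfst w" "msnd (z - w) = msnd z - msnd w"
  "mfst (- z) = - mfst z" "msnd (- z) = - msnd z"
  "mfst (r *\<^sub>R z) = r *\<^sub>R mfst z" "msnd (r *\<^sub>R z) = r *\<^sub>R msnd z"
  by (simp_all add: zero_max_prod_def plus_max_prod_def minus_max_prod_def uminus_max_prod_def
      scaleR_max_prod_def)

instantiation max_prod :: (real_normed_vector, real_normed_vector) real_normed_vector
begin

definition norm_max_prod_def: "norm z = max (norm (mfst z)) (norm (msnd z))"
definition dist_max_prod_def: "dist z w = norm (z - w)" for z w :: "('a, 'b) max_prod"
definition sgn_max_prod_def: "sgn z = z /\<^sub>R norm z" for z :: "('a, 'b) max_prod"
definition uniformity_max_prod_def:
  "(uniformity :: (('a, 'b) max_prod \<times> ('a, 'b) max_prod) filter) =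
    (INF e\<in>{0<..}. principal {(z, w). dist z w < e})"
definition open_max_prod_def:
  "open U = (\<forall>z\<in>U. \<forall>\<^sub>F (z', w) in uniformity. z' = z \<longrightarrow> w \<in> U)" for U :: "('a, 'b) max_prod set"

instance
proof
  fix z w :: "('a, 'b) max_prod" and r :: real
  show "(norm z = 0) = (z = 0)"
    by (cases z) (auto simp: norm_max_prod_def zero_max_prod_def max_def)
  show "norm (z + w) \<le> norm z + norm w"
    using norm_triangle_ineq[of "mfst z" "mfst w"] norm_triangle_ineq[of "msnd z" "msnd w"]
    by (auto simp: norm_max_prod_def)
  show "norm (r *\<^sub>R z) = \<bar>r\<bar> * norm z"
    by (simp add: norm_max_prod_def max_mult_distrib_left)
qed (fact dist_max_prod_def sgn_max_prod_def uniformity_max_prod_def open_max_prod_def)+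

end

instance max_prod :: (banach, banach) banach
proof
  fix Z :: "nat \<Rightarrow> ('a, 'b) max_prod"
  assume Z: "Cauchy Z"
  have "dist (mfst z) (mfst w) \<le> dist z w" "dist (msnd z) (msnd w) \<le> dist z w"
    for z w :: "('a, 'b) max_prod"
    by (auto simp: dist_norm norm_max_prod_def)
  then have "Cauchy (\<lambda>n. mfst (Z n))" "Cauchy (\<lambda>n. msnd (Z n))"
    using Z unfolding Cauchy_def by (meson le_less_trans)+
  then obtain a b where ab: "(\<lambda>n. mfst (Z n)) \<longlonglongrightarrow> a" "(\<lambda>n. msnd (Z n)) \<longlonglongrightarrow> b"
    by (auto simp: Cauchy_convergent_iff convergent_def)
  have "(\<lambda>n. max (norm (mfst (Z n) - a)) (norm (msnd (Z n) - b))) \<longlonglongrightarrow> max 0 0"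
    using ab by (intro tendsto_max) (simp_all add: LIM_zero tendsto_norm_zero)
  then have "(\<lambda>n. norm (Z n - MaxPair a b)) \<longlonglongrightarrow> 0"
    by (simp add: norm_max_prod_def)
  then have "Z \<longlonglongrightarrow> MaxPair a b"
    by (rule LIM_zero_cancel[OF tendsto_norm_zero_cancel])
  then show "convergent Z"
    by (auto simp: convergent_def)
qed

text \<open>The filter of \<open>n \<rightarrow> \<infinity>\<close> along an infinite index set \<open>N\<close>.\<close>

abbreviation along :: "nat set \<Rightarrow> nat filter"
  where "along N \<equiv> inf sequentially (principal N)"

definition relatively_compact :: "'a::topological_space set \<Rightarrow> bool"
  where "relatively_compact S \<longleftrightarrow> compact (closure S)"

text \<open>For \<open>M = {0}\<close>, where the supremum is over the empty set, the gap is taken to be 0.\<close>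

definition gap :: "'z::real_normed_vector set \<Rightarrow> 'z set \<Rightarrow> real"
  where "gap M P = (if M \<subseteq> {0} then 0 else (SUP x\<in>{x \<in> M. norm x = 1}. infdist x P))"

text \<open>The arguments \<open>M n\<close>, \<open>P n\<close> are meant to be closed subspaces. Indices \<open>n\<close> with \<open>M n = {0}\<close>
  carry no unit vector and impose no condition. For subspaces, \<open>l = 1\<close> is always
  admissible (take \<open>y n = 0\<close> and \<open>z = 0\<close>), so the infimum below is over a nonempty set.\<close>

definition lower_uniformly_adjusted ::
    "nat set \<Rightarrow> (nat \<Rightarrow> 'z::real_normed_vector set) \<Rightarrow> (nat \<Rightarrow> 'z set) \<Rightarrow> real \<Rightarrow> bool"
  where "lower_uniformly_adjusted N M P l \<longleftrightarrow> 0 \<le> l \<and>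
    (\<forall>\<eta>>0. \<forall>N'. N' \<subseteq> N \<and> infinite N' \<longrightarrow>
      (\<forall>x. (\<forall>n\<in>N'. x n \<in> M n \<and> norm (x n) = 1) \<longrightarrow>
        (\<exists>N'' y z. N'' \<subseteq> N' \<and> infinite N'' \<and> (\<forall>n\<in>N''. y n \<in> P n) \<and>
          Limsup (along N'') (\<lambda>n. ereal (norm (x n - y n - z))) \<le> ereal (l + \<eta>))))"

definition adjustment ::
    "nat set \<Rightarrow> (nat \<Rightarrow> 'z::real_normed_vector set) \<Rightarrow> (nat \<Rightarrow> 'z set) \<Rightarrow> real"
  where "adjustment N M P = Inf {l. lower_uniformly_adjusted N M P l}"

text \<open>A possibly not everywhere defined operator is a partial function, with domain \<^const>\<open>dom\<close>.\<close>

definition linear_operator :: "('a::real_vector \<rightharpoonup> 'b::real_vector) \<Rightarrow> bool"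
  where "linear_operator A \<longleftrightarrow> subspace (dom A) \<and>
    (\<forall>x\<in>dom A. \<forall>y\<in>dom A. the (A (x + y)) = the (A x) + the (A y)) \<and>
    (\<forall>r. \<forall>x\<in>dom A. the (A (r *\<^sub>R x)) = r *\<^sub>R the (A x))"

definition op_graph :: "('a \<rightharpoonup> 'b) \<Rightarrow> ('a, 'b) max_prod set"
  where "op_graph A = {MaxPair x y | x y. A x = Some y}"

definition closed_operator :: "('a::real_normed_vector \<rightharpoonup> 'b::real_normed_vector) \<Rightarrow> bool"
  where "closed_operator A \<longleftrightarrow> linear_operator A \<and> closed (op_graph A)"

definition op_plus :: "('a \<rightharpoonup> 'b::plus) \<Rightarrow> ('a \<rightharpoonup> 'b) \<Rightarrow> ('a \<rightharpoonup> 'b)"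
  where "op_plus A B =
    (\<lambda>x. if x \<in> dom A \<inter> dom B then Some (the (A x) + the (B x)) else None)"

definition bounded_op :: "('a::real_normed_vector \<Rightarrow>\<^sub>L 'b::real_normed_vector) \<Rightarrow> ('a \<rightharpoonup> 'b)"
  where "bounded_op C = (\<lambda>x. Some (blinfun_apply C x))"

definition op_gap ::
    "('a::real_normed_vector \<rightharpoonup> 'b::real_normed_vector) \<Rightarrow> ('a \<rightharpoonup> 'b) \<Rightarrow> real"
  where "op_gap A B = gap (op_graph A) (op_graph B)"

definition op_adjustment ::
    "nat set \<Rightarrow> (nat \<Rightarrow> 'a::real_normed_vector \<rightharpoonup> 'b::real_normed_vector)
      \<Rightarrow> (nat \<Rightarrow> 'a \<rightharpoonup> 'b) \<Rightarrow> real"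
  where "op_adjustment N A B = adjustment N (\<lambda>n. op_graph (A n)) (\<lambda>n. op_graph (B n))"

text \<open>\<open>compact_relative_to A C\<close>: \<open>C\<close> is \<open>A\<close>-compact.\<close>

definition compact_relative_to ::
    "('a::real_normed_vector \<rightharpoonup> 'b::real_normed_vector) \<Rightarrow> ('a \<rightharpoonup> 'b) \<Rightarrow> bool"
  where "compact_relative_to A C \<longleftrightarrow> dom A \<subseteq> dom C \<and>
    (\<forall>x :: nat \<Rightarrow> 'a. (\<forall>n. x n \<in> dom A) \<and> bounded (range (\<lambda>n. MaxPair (x n) (the (A (x n)))))
      \<longrightarrow> relatively_compact (range (\<lambda>n. the (C (x n)))))"

definition hausdorff_noncompactness :: "'b::metric_space set \<Rightarrow> real"
  where "hausdorff_noncompactness M =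
    Inf {e. 0 < e \<and> (\<exists>F. finite F \<and> M \<subseteq> (\<Union>y\<in>F. ball y e))}"

definition q_norm :: "('a::real_normed_vector \<Rightarrow>\<^sub>L 'b::real_normed_vector) \<Rightarrow> real"
  where "q_norm C = hausdorff_noncompactness (blinfun_apply C ` cball 0 1)"

definition compact_operator :: "('a::real_normed_vector \<Rightarrow>\<^sub>L 'b::real_normed_vector) \<Rightarrow> bool"
  where "compact_operator C \<longleftrightarrow> relatively_compact (blinfun_apply C ` cball 0 1)"

definition K2_approximates_null ::
    "nat set \<Rightarrow> (nat \<Rightarrow> 'a::real_normed_vector \<rightharpoonup> 'b::real_normed_vector) \<Rightarrow> bool"
  where "K2_approximates_null N C \<longleftrightarrow>
    (\<forall>x. (\<forall>n\<in>N. x n \<in> dom (C n)) \<and> bounded (x ` N)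
      \<longrightarrow> relatively_compact ((\<lambda>n. the (C n (x n))) ` N))"

end

(* A unit vector of the graph of A is (u, A u) with norm u \<le> 1, and subtracting the vector
   (u, A u + C u) of the graph of A + C leaves (0, - C u). So the adjustment constant of the pair
   is controlled by how well sequences C_n u_n are approximated, along subsequences, by single
   vectors. If the values C_n u_n are covered by finitely many balls of radius e, then by the
   pigeonhole principle infinitely many of them lie in one ball, whose centre serves as the
   common vector z. Parts 2 to 6 are the cases in which such a cover is at hand. *)

theory Submission
  imports Defs
begin

section \<open>Admissible numbers and the adjustment constant of sequences of subspaces\<close>

text \<open>A bound valid at every index of \<open>N''\<close> bounds the upper limit along
  \<open>N''\<close>. Nothing is lost by asking for it: a smaller \<eta> and the removal of finitely
  many indices turn a bound on the upper limit into a pointwise one. Later proofs can thus avoid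
  \<open>Limsup\<close> and \<open>ereal\<close>.\<close>

lemma lower_uniformly_adjustedI:
  assumes "0 \<le> l"
    and "\<And>\<eta> N' x. \<lbrakk>\<eta> > 0; N' \<subseteq> N; infinite N'; \<And>n. n \<in> N' \<Longrightarrow> x n \<in> M n \<and> norm (x n) = 1\<rbrakk>
      \<Longrightarrow> \<exists>N'' y z. N'' \<subseteq> N' \<and> infinite N'' \<and>
        (\<forall>n\<in>N''. y n \<in> P n \<and> norm (x n - y n - z) \<le> l + \<eta>)"
  shows "lower_uniformly_adjusted N M P l"
  unfolding lower_uniformly_adjusted_def
proof (intro conjI allI impI)
  fix \<eta> :: real and N' x
  assume "\<eta> > 0" "N' \<subseteq> N \<and> infinite N'" "\<forall>n\<in>N'. x n \<in> M n \<and> norm (x n) = 1"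
  with assms(2)[of \<eta> N' x] obtain N'' y z where *: "N'' \<subseteq> N'" "infinite N''"
      "\<forall>n\<in>N''. y n \<in> P n \<and> norm (x n - y n - z) \<le> l + \<eta>"
    by blast
  moreover have "Limsup (along N'') (\<lambda>n. ereal (norm (x n - y n - z))) \<le> ereal (l + \<eta>)"
    using * by (intro Limsup_bounded) (auto simp: eventually_inf_principal)
  ultimately show "\<exists>N'' y z. N'' \<subseteq> N' \<and> infinite N'' \<and> (\<forall>n\<in>N''. y n \<in> P n) \<and>
      Limsup (along N'') (\<lambda>n. ereal (norm (x n - y n - z))) \<le> ereal (l + \<eta>)"
    by blast
qed (fact assms(1))

lemma adjustment_le:
  assumes "lower_uniformly_adjusted N M P l"
  shows "adjustment N M P \<le> l"
  unfolding adjustment_def using assms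
  by (intro cInf_lower bdd_belowI[of _ 0]) (auto simp: lower_uniformly_adjusted_def)

lemma adjustment_eq_0:
  assumes "lower_uniformly_adjusted N M P 0"
  shows "adjustment N M P = 0"
proof (rule antisym[OF adjustment_le[OF assms]])
  show "0 \<le> adjustment N M P"
    unfolding adjustment_def
  proof (rule cInf_greatest)
    \<comment> \<open>\<open>Inf\<close> of an empty set of reals says nothing, so a member has to
      be exhibited; 0 is one.\<close>
    show "{l. lower_uniformly_adjusted N M P l} \<noteq> {}"
      using assms by blast
  qed (simp add: lower_uniformly_adjusted_def)
qed

section \<open>The gap as an upper bound for the adjustment constant\<close>

lemma infdist_le_norm: "0 \<in> P \<Longrightarrow> infdist x P \<le> norm x"
  using infdist_le[of 0 P x] by simp

text \<open>A real supremum dominates its members only if they are bounded above. Here 0 lies in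
  \<open>P\<close>, so a unit vector has distance at most 1 from \<open>P\<close>.\<close>

lemma infdist_le_gap:
  assumes "0 \<in> P" "x \<in> M" "norm x = 1"
  shows "infdist x P \<le> gap M P"
proof -
  have "bdd_above ((\<lambda>x. infdist x P) ` {x \<in> M. norm x = 1})"
    using infdist_le_norm[OF assms(1)] by (intro bdd_aboveI2[of _ _ 1]) (metis (mono_tags) mem_Collect_eq)
  moreover have "\<not> M \<subseteq> {0}"
    using assms by auto
  ultimately show ?thesis
    using assms by (auto simp: gap_def intro!: cSUP_upper)
qed

text \<open>A nonzero vector of \<open>M\<close>, once normalised, contributes a nonnegative
  distance to the supremum; for trivial \<open>M\<close> the conventional value 0 applies.\<close>

lemma gap_nonneg:
  assumes "0 \<in> P" "subspace M"
  shows "0 \<le> gap M P"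
proof (cases "M \<subseteq> {0}")
  case False
  then obtain v where "v \<in> M" "v \<noteq> 0"
    by blast
  then have "v /\<^sub>R norm v \<in> M" "norm (v /\<^sub>R norm v) = 1"
    using assms by (auto intro: subspace_scale)
  then show ?thesis
    using infdist_le_gap[OF assms(1)] infdist_nonneg order_trans by blast
qed (simp add: gap_def)

text \<open>Only finitely many indices of \<open>N\<close> can violate \<open>Q\<close>, so removing
  them from \<open>N'\<close> leaves an infinite set. This is how a property valid in the limit
  yields a subsequence.\<close>

lemma infinite_Int_eventually_along:
  assumes "infinite N'" "N' \<subseteq> N" "eventually Q (along N)"
  shows "infinite {n \<in> N'. Q n}"
proof -
  obtain n0 where "\<And>n. n \<ge> n0 \<Longrightarrow> n \<in> N \<Longrightarrow> Q n"
    using assms(3) by (auto simp: eventually_inf_principal eventually_sequentially)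
  then have "N' - {..<n0} \<subseteq> {n \<in> N'. Q n}"
    using assms(2) by auto
  then show ?thesis
    using assms(1) by (metis Diff_infinite_finite finite_lessThan infinite_super)
qed

text \<open>Every real \<open>l\<close> not below the upper limit of the gaps is admissible: where
  the gap is less than \<open>l + \<eta>\<close>, each unit vector of \<open>M n\<close> has a point
  of \<open>P n\<close> within that distance, and the common vector can be 0.\<close>

lemma adjustment_le_Limsup_gap:
  assumes "infinite N" "\<And>n. n \<in> N \<Longrightarrow> subspace (M n)" "\<And>n. n \<in> N \<Longrightarrow> 0 \<in> P n"
  shows "ereal (adjustment N M P) \<le> Limsup (along N) (\<lambda>n. ereal (gap (M n) (P n)))"
    (is "_ \<le> ?L")
\<comment> \<open>Testing against real upper bounds \<open>l\<close> also settles an infinite upper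
  limit, for which no such \<open>l\<close> exists.\<close>
proof (rule ereal_le_real)
  fix l assume "?L \<le> ereal l"
  have below: "eventually (\<lambda>n. gap (M n) (P n) < l + \<eta>) (along N)" if "\<eta> > 0" for \<eta>
  proof -
    have "?L < ereal (l + \<eta>)"
      using \<open>?L \<le> ereal l\<close> that by (intro le_less_trans[of ?L]) auto
    then show ?thesis
      by (auto dest!: Limsup_lessD)
  qed
  \<comment> \<open>Admissible numbers are nonnegative by definition. At some index the gap, itself
    nonnegative, is less than \<open>l + \<eta>\<close>; then \<eta> tends to 0.\<close>
  have "0 \<le> l"
  proof (rule field_le_epsilon)
    fix \<eta> :: real assume "\<eta> > 0"
    then obtain n where "n \<in> N" "gap (M n) (P n) < l + \<eta>"
      using infinite_Int_eventually_along[OF assms(1) subset_refl below] infinite_imp_nonempty by blast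
    then show "0 \<le> l + \<eta>"
      using gap_nonneg[OF assms(3,2), of n n] by simp
  qed
  moreover have "lower_uniformly_adjusted N M P l"
  proof (rule lower_uniformly_adjustedI[OF \<open>0 \<le> l\<close>])
    fix \<eta> :: real and N' x
    assume \<eta>: "\<eta> > 0" and N': "N' \<subseteq> N" "infinite N'"
      and x: "\<And>n. n \<in> N' \<Longrightarrow> x n \<in> M n \<and> norm (x n) = 1"
    define N'' where "N'' = {n \<in> N'. gap (M n) (P n) < l + \<eta>}"
    have "\<exists>y. y \<in> P n \<and> norm (x n - y - 0) \<le> l + \<eta>" if "n \<in> N''" for n
    proof -
      have n: "n \<in> N'" "gap (M n) (P n) < l + \<eta>" "0 \<in> P n"
        using that N' assms(3) by (auto simp: N''_def)
      then have "infdist (x n) (P n) < l + \<eta>"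
        using infdist_le_gap[of "P n" "x n" "M n"] x by fastforce
      \<comment> \<open>The distance to \<open>P n\<close> need not be attained; the strict
        inequality still provides an actual point \<open>y\<close>.\<close>
      then have "Inf (dist (x n) ` P n) < l + \<eta>"
        using n(3) by (metis empty_iff infdist_notempty)
      then obtain y where "y \<in> P n" "dist (x n) y < l + \<eta>"
        using n(3) by (auto dest!: cInf_lessD[rotated])
      then show ?thesis
        by (auto simp: dist_norm)
    qed
    then obtain y where "\<forall>n\<in>N''. y n \<in> P n \<and> norm (x n - y n - 0) \<le> l + \<eta>"
      by metis
    moreover have "infinite N''" "N'' \<subseteq> N'"
      using infinite_Int_eventually_along[OF N'(2,1) below[OF \<eta>]] by (auto simp: N''_def)
    ultimately show "\<exists>N'' y z. N'' \<subseteq> N' \<and> infinite N'' \<and>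
        (\<forall>n\<in>N''. y n \<in> P n \<and> norm (x n - y n - z) \<le> l + \<eta>)"
      by blast
  qed
  ultimately show "ereal (adjustment N M P) \<le> ereal l"
    by (simp add: adjustment_le)
qed

section \<open>Finite covers by balls and the choice of subsequences\<close>

text \<open>The indices, not the values, are distributed among the balls, so the argument also works
  when \<open>f\<close> takes only finitely many values on \<open>N\<close>.\<close>

lemma infinite_subset_in_ball:
  assumes "infinite N" "finite F" "f ` N \<subseteq> (\<Union>y\<in>F. ball y e)"
  obtains N' w where "N' \<subseteq> N" "infinite N'" "\<And>n. n \<in> N' \<Longrightarrow> dist w (f n) < e"
proof -
  have "N \<subseteq> (\<Union>y\<in>F. {n \<in> N. dist y (f n) < e})"
    using assms(3) by (auto simp: image_subset_iff)
  then have "infinite (\<Union>y\<in>F. {n \<in> N. dist y (f n) < e})"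
    using assms(1) infinite_super by blast
  then obtain w where "infinite {n \<in> N. dist w (f n) < e}"
    using assms(2) by auto
  then show thesis
    by (intro that[of "{n \<in> N. dist w (f n) < e}" w]) auto
qed

lemma relatively_compact_imp_finite_cover:
  fixes S :: "'a::metric_space set"
  assumes "relatively_compact S" "e > 0"
  shows "\<exists>F. finite F \<and> S \<subseteq> (\<Union>y\<in>F. ball y e)"
proof -
  have "closure S \<subseteq> (\<Union>y\<in>closure S. ball y e)"
    using assms(2) by auto
  then obtain F where "finite F" "closure S \<subseteq> (\<Union>y\<in>F. ball y e)"
    using assms(1) unfolding relatively_compact_def by (metis compactE_image open_ball)
  then show ?thesis
    using closure_subset by blast
qed

text \<open>Reflecting the centres in 0 suffices. This serves the passage from \<open>A + C\<close>
  back to \<open>A\<close>, where the second components differ by \<open>- C u\<close>.\<close>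

lemma finite_cover_uminus:
  fixes f :: "'i \<Rightarrow> 'a::real_normed_vector"
  assumes "\<exists>F. finite F \<and> f ` N \<subseteq> (\<Union>y\<in>F. ball y e)"
  shows "\<exists>F. finite F \<and> (\<lambda>n. - f n) ` N \<subseteq> (\<Union>y\<in>F. ball y e)"
proof -
  obtain F where "finite F" "f ` N \<subseteq> (\<Union>y\<in>F. ball y e)"
    using assms by blast
  moreover have "dist (- a) (- b) = dist a b" for a b :: 'a
    by (simp add: dist_norm norm_minus_commute)
  ultimately show ?thesis
    by (intro exI[of _ "uminus ` F"]) fastforce
qed

section \<open>Graphs of operators and of their perturbations\<close>

lemma op_graph_iff: "z \<in> op_graph A \<longleftrightarrow> mfst z \<in> dom A \<and> msnd z = the (A (mfst z))"
  by (cases z) (auto simp: op_graph_def)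

lemma subspace_op_graph:
  assumes "linear_operator A"
  shows "subspace (op_graph A)"
proof -
  have "the (A 0) = 0"
    using assms unfolding linear_operator_def by (metis scaleR_zero_left subspace_0)
  then show ?thesis
    using assms by (simp add: linear_operator_def subspace_def op_graph_iff)
qed

text \<open>The inclusion of domains allows vectors of the two graphs to be compared over the same
  point \<open>u n\<close>. The first components cancel, and the maximum norm of what remains is a
  norm in the second space alone, so covers there are enough.\<close>

lemma op_graphs_lower_uniformly_adjusted:
  fixes A B :: "nat \<Rightarrow> 'a::real_normed_vector \<rightharpoonup> 'b::real_normed_vector"
  assumes "0 \<le> l" and dom: "\<And>n. n \<in> N \<Longrightarrow> dom (A n) \<subseteq> dom (B n)"
    and cover: "\<And>\<eta> N' u. \<lbrakk>\<eta> > 0; N' \<subseteq> N; infinite N';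
        \<And>n. n \<in> N' \<Longrightarrow> u n \<in> dom (A n) \<and> norm (MaxPair (u n) (the (A n (u n)))) = 1\<rbrakk>
      \<Longrightarrow> \<exists>F. finite F \<and> (\<lambda>n. the (B n (u n)) - the (A n (u n))) ` N' \<subseteq> (\<Union>y\<in>F. ball y (l + \<eta>))"
  shows "lower_uniformly_adjusted N (\<lambda>n. op_graph (A n)) (\<lambda>n. op_graph (B n)) l"
proof (rule lower_uniformly_adjustedI[OF \<open>0 \<le> l\<close>])
  fix \<eta> :: real and N' and x :: "nat \<Rightarrow> ('a, 'b) max_prod"
  assume \<eta>: "\<eta> > 0" and N': "N' \<subseteq> N" "infinite N'"
    and x: "\<And>n. n \<in> N' \<Longrightarrow> x n \<in> op_graph (A n) \<and> norm (x n) = 1"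
  define u where "u n = mfst (x n)" for n
  have xu: "u n \<in> dom (A n)" "x n = MaxPair (u n) (the (A n (u n)))" if "n \<in> N'" for n
    using x[OF that] by (auto simp: u_def op_graph_iff intro: max_prod.expand)
  define d where "d n = the (B n (u n)) - the (A n (u n))" for n
  obtain F where "finite F" "d ` N' \<subseteq> (\<Union>y\<in>F. ball y (l + \<eta>))"
    using cover[OF \<eta> N', of u] xu x unfolding d_def by metis
  then obtain N'' w where N'': "N'' \<subseteq> N'" "infinite N''" "\<And>n. n \<in> N'' \<Longrightarrow> dist w (d n) < l + \<eta>"
    using infinite_subset_in_ball[OF N'(2)] by metis
  define y where "y n = MaxPair (u n) (the (B n (u n)))" for n
  have "y n \<in> op_graph (B n)" if "n \<in> N''" for n
    unfolding op_graph_iff y_def using that xu(1) dom N' N''(1) by simp blast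
  \<comment> \<open>Since \<open>x n - y n\<close> is \<open>MaxPair 0 (- d n)\<close>, the centre
    \<open>w\<close> of the ball for \<open>d\<close> enters the common vector with a minus
    sign.\<close>
  moreover have "norm (x n - y n - MaxPair 0 (- w)) \<le> l + \<eta>" if "n \<in> N''" for n
  proof -
    have "norm (x n - y n - MaxPair 0 (- w)) = dist w (d n)"
      using that xu N'' by (auto simp: y_def d_def norm_max_prod_def dist_norm algebra_simps)
    then show ?thesis
      using N''(3)[OF that] by simp
  qed
  ultimately show "\<exists>N'' y z. N'' \<subseteq> N' \<and> infinite N'' \<and>
      (\<forall>n\<in>N''. y n \<in> op_graph (B n) \<and> norm (x n - y n - z) \<le> l + \<eta>)"
    using N'' by blast
qed

lemma norm_le_1_if_norm_MaxPair: "norm (MaxPair u v) = 1 \<Longrightarrow> norm u \<le> 1"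
  by (simp add: norm_max_prod_def)

lemma dom_bounded_op [simp]: "dom (bounded_op C) = UNIV"
  by (auto simp: bounded_op_def)

lemma the_bounded_op [simp]: "the (bounded_op C x) = C x"
  by (simp add: bounded_op_def)

lemma dom_op_plus [simp]: "dom (op_plus A B) = dom A \<inter> dom B"
  by (auto simp: op_plus_def split: if_splits)

lemma the_op_plus [simp]: "x \<in> dom A \<Longrightarrow> x \<in> dom B \<Longrightarrow> the (op_plus A B x) = the (A x) + the (B x)"
  by (simp add: op_plus_def)

text \<open>An everywhere defined \<open>C n\<close> leaves the domain of \<open>A\<close>
  unchanged, so both directions are possible. In the maximum norm, a unit vector of either graph has
  first component of norm at most 1; hence one covering condition on the unit ball serves
  both.\<close>

lemma bounded_perturbation_lower_uniformly_adjusted: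
  fixes A :: "'a::real_normed_vector \<rightharpoonup> 'b::real_normed_vector" and C :: "nat \<Rightarrow> 'a \<Rightarrow>\<^sub>L 'b"
  assumes "0 \<le> l"
    and cover: "\<And>\<eta> N' u. \<lbrakk>\<eta> > 0; N' \<subseteq> N; \<And>n. n \<in> N' \<Longrightarrow> norm (u n) \<le> 1\<rbrakk>
      \<Longrightarrow> \<exists>F. finite F \<and> (\<lambda>n. C n (u n)) ` N' \<subseteq> (\<Union>y\<in>F. ball y (l + \<eta>))"
  shows "lower_uniformly_adjusted N (\<lambda>n. op_graph A)
      (\<lambda>n. op_graph (op_plus A (bounded_op (C n)))) l" (is ?forth)
    and "lower_uniformly_adjusted N (\<lambda>n. op_graph (op_plus A (bounded_op (C n))))
      (\<lambda>n. op_graph A) l" (is ?back)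
proof -
  show ?forth
  proof (rule op_graphs_lower_uniformly_adjusted[OF \<open>0 \<le> l\<close>])
    fix \<eta> :: real and N' u
    assume "\<eta> > 0" "N' \<subseteq> N"
      and u: "\<And>n. n \<in> N' \<Longrightarrow> u n \<in> dom A \<and> norm (MaxPair (u n) (the (A (u n)))) = 1"
    then have "\<exists>F. finite F \<and> (\<lambda>n. C n (u n)) ` N' \<subseteq> (\<Union>y\<in>F. ball y (l + \<eta>))"
      using norm_le_1_if_norm_MaxPair by (intro cover) blast+
    moreover have "(\<lambda>n. the (op_plus A (bounded_op (C n)) (u n)) - the (A (u n))) ` N'
        = (\<lambda>n. C n (u n)) ` N'"
      using u by (intro image_cong) auto
    ultimately show "\<exists>F. finite F \<and>
        (\<lambda>n. the (op_plus A (bounded_op (C n)) (u n)) - the (A (u n))) ` N' \<subseteq> (\<Union>y\<in>F. ball y (l + \<eta>))"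
      by simp
  qed simp
  show ?back
  proof (rule op_graphs_lower_uniformly_adjusted[OF \<open>0 \<le> l\<close>])
    fix \<eta> :: real and N' u
    assume "\<eta> > 0" "N' \<subseteq> N"
      and u: "\<And>n. n \<in> N' \<Longrightarrow> u n \<in> dom (op_plus A (bounded_op (C n))) \<and>
        norm (MaxPair (u n) (the (op_plus A (bounded_op (C n)) (u n)))) = 1"
    then have "\<exists>F. finite F \<and> (\<lambda>n. - C n (u n)) ` N' \<subseteq> (\<Union>y\<in>F. ball y (l + \<eta>))"
      using norm_le_1_if_norm_MaxPair by (intro finite_cover_uminus cover) blast+
    moreover have "(\<lambda>n. the (A (u n)) - the (op_plus A (bounded_op (C n)) (u n))) ` N'
        = (\<lambda>n. - C n (u n)) ` N'"
      using u by (intro image_cong) auto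
    ultimately show "\<exists>F. finite F \<and>
        (\<lambda>n. the (A (u n)) - the (op_plus A (bounded_op (C n)) (u n))) ` N' \<subseteq> (\<Union>y\<in>F. ball y (l + \<eta>))"
      by simp
  qed simp
qed

lemmas adjustment_bounded_perturbation_eq_0 =
  bounded_perturbation_lower_uniformly_adjusted[where l = 0, THEN adjustment_eq_0,
    folded op_adjustment_def, simplified]

section \<open>Covers for null sequences, \<open>K2\<close>-approximation and relative
  compactness\<close>

text \<open>From \<open>n0\<close> on the values lie in the ball of radius \<open>e\<close> about 0;
  the finitely many earlier values serve as their own centres.\<close>

lemma finite_cover_null_sequence:
  fixes C :: "nat \<Rightarrow> 'a::real_normed_vector \<Rightarrow>\<^sub>L 'b::real_normed_vector"
  assumes "((\<lambda>n. norm (C n)) \<longlongrightarrow> 0) (along N)" "e > 0" "N' \<subseteq> N" "\<And>n. n \<in> N' \<Longrightarrow> norm (u n) \<le> 1"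
  shows "\<exists>F. finite F \<and> (\<lambda>n. C n (u n)) ` N' \<subseteq> (\<Union>y\<in>F. ball y e)"
proof -
  have "eventually (\<lambda>n. norm (C n) < e) (along N)"
    using order_tendstoD(2)[OF assms(1,2)] .
  then obtain n0 where n0: "\<And>n. n \<ge> n0 \<Longrightarrow> n \<in> N \<Longrightarrow> norm (C n) < e"
    by (auto simp: eventually_inf_principal eventually_sequentially)
  have "C n (u n) \<in> (\<Union>y\<in>insert 0 ((\<lambda>n. C n (u n)) ` {..<n0}). ball y e)" if "n \<in> N'" for n
  proof (cases "n < n0")
    case False
    have "norm (C n (u n)) \<le> norm (C n) * norm (u n)"
      by (rule norm_blinfun)
    also have "\<dots> \<le> norm (C n)"
      using assms(4)[OF that] by (simp add: mult_left_le)
    also have "\<dots> < e"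
      using False n0 that assms(3) by auto
    finally show ?thesis
      by simp
  next
    case True
    then show ?thesis
      using \<open>e > 0\<close> by (auto intro!: bexI[of _ n])
  qed
  then show ?thesis
    by (intro exI[of _ "insert 0 ((\<lambda>n. C n (u n)) ` {..<n0})"]) blast
qed

lemma finite_cover_K2_approximates_null:
  fixes C :: "nat \<Rightarrow> 'a::real_normed_vector \<Rightarrow>\<^sub>L 'b::real_normed_vector"
  assumes "K2_approximates_null N (\<lambda>n. bounded_op (C n))" "e > 0" "N' \<subseteq> N"
    and u: "\<And>n. n \<in> N' \<Longrightarrow> norm (u n) \<le> 1"
  shows "\<exists>F. finite F \<and> (\<lambda>n. C n (u n)) ` N' \<subseteq> (\<Union>y\<in>F. ball y e)"
proof -
  \<comment> \<open>The compactness hypothesis concerns sequences on all of \<open>N\<close>;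
    extending by 0 keeps the sequence bounded.\<close>
  define v where "v n = (if n \<in> N' then u n else 0)" for n
  have "bounded (v ` N)"
    using u by (auto simp: v_def bounded_iff intro!: exI[of _ 1])
  then have "relatively_compact ((\<lambda>n. C n (v n)) ` N)"
    using assms(1) by (simp add: K2_approximates_null_def)
  then obtain F where "finite F" "(\<lambda>n. C n (v n)) ` N \<subseteq> (\<Union>y\<in>F. ball y e)"
    using relatively_compact_imp_finite_cover[OF _ \<open>e > 0\<close>] by blast
  moreover have "(\<lambda>n. C n (u n)) ` N' \<subseteq> (\<lambda>n. C n (v n)) ` N"
    using \<open>N' \<subseteq> N\<close> by (auto simp: v_def)
  ultimately show ?thesis
    by (meson order_trans)
qed

lemma finite_cover_compact_relative_to:
  fixes u :: "nat \<Rightarrow> 'a::real_normed_vector" and A C :: "'a \<rightharpoonup> 'b::real_normed_vector"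
  assumes "compact_relative_to A C" "e > 0" "infinite N"
    and u: "\<And>n. n \<in> N \<Longrightarrow> u n \<in> dom A \<and> norm (MaxPair (u n) (the (A (u n)))) = 1"
  shows "\<exists>F. finite F \<and> (\<lambda>n. the (C (u n))) ` N \<subseteq> (\<Union>y\<in>F. ball y e)"
proof -
  \<comment> \<open>Relative compactness is tested on sequences over all natural numbers. Filling
    the missing indices with a term \<open>u m\<close> keeps the sequence in \<open>dom A\<close>
    and its graph vectors of norm 1.\<close>
  obtain m where "m \<in> N"
    using \<open>infinite N\<close> infinite_imp_nonempty by blast
  define v where "v n = (if n \<in> N then u n else u m)" for n
  have v: "v n \<in> dom A \<and> norm (MaxPair (v n) (the (A (v n)))) = 1" for n
    using u \<open>m \<in> N\<close> by (simp add: v_def)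
  then have "bounded (range (\<lambda>n. MaxPair (v n) (the (A (v n)))))"
    by (auto simp: bounded_iff intro!: exI[of _ 1])
  then have "relatively_compact (range (\<lambda>n. the (C (v n))))"
    using assms(1) v unfolding compact_relative_to_def by blast
  then obtain F where "finite F" "range (\<lambda>n. the (C (v n))) \<subseteq> (\<Union>y\<in>F. ball y e)"
    using relatively_compact_imp_finite_cover[OF _ \<open>e > 0\<close>] by blast
  moreover have "(\<lambda>n. the (C (u n))) ` N \<subseteq> range (\<lambda>n. the (C (v n)))"
    by (auto simp: v_def)
  ultimately show ?thesis
    by (meson order_trans)
qed

text \<open>A unit vector of the graph of \<open>A\<close> bounds both \<open>u\<close> and
  \<open>A u\<close>, which is what the hypothesis on \<open>C\<close> asks for. A unit vector of
  the graph of \<open>A + C\<close> bounds only \<open>u\<close> and \<open>A u + C u\<close>, with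
  no immediate bound on \<open>A u\<close>; hence the single direction.\<close>

lemma adjustment_relatively_compact_perturbation:
  assumes "compact_relative_to A C"
  shows "op_adjustment N (\<lambda>n. A) (\<lambda>n. op_plus A C) = 0"
  unfolding op_adjustment_def
proof (intro adjustment_eq_0 op_graphs_lower_uniformly_adjusted)
  have dom: "dom A \<subseteq> dom C"
    using assms by (simp add: compact_relative_to_def)
  then show "dom A \<subseteq> dom (op_plus A C)"
    by simp
  fix \<eta> :: real and N' :: "nat set" and u
  assume "\<eta> > 0" "infinite N'"
    and u: "\<And>n. n \<in> N' \<Longrightarrow> u n \<in> dom A \<and> norm (MaxPair (u n) (the (A (u n)))) = 1"
  then have "\<exists>F. finite F \<and> (\<lambda>n. the (C (u n))) ` N' \<subseteq> (\<Union>y\<in>F. ball y \<eta>)"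
    by (intro finite_cover_compact_relative_to[OF assms])
  moreover have "(\<lambda>n. the (op_plus A C (u n)) - the (A (u n))) ` N' = (\<lambda>n. the (C (u n))) ` N'"
    using u dom by (intro image_cong refl) (subst the_op_plus, auto)
  ultimately show "\<exists>F. finite F \<and>
      (\<lambda>n. the (op_plus A C (u n)) - the (A (u n))) ` N' \<subseteq> (\<Union>y\<in>F. ball y (0 + \<eta>))"
    by simp
qed simp

section \<open>The q-norm and covers of the image of the unit ball\<close>

lemma q_norm_cover_nonempty:
  fixes C :: "'a::real_normed_vector \<Rightarrow>\<^sub>L 'b::real_normed_vector"
  shows "\<exists>e>0. \<exists>F. finite F \<and> blinfun_apply C ` cball 0 1 \<subseteq> (\<Union>y\<in>F. ball y e)"
\<comment> \<open>The summand 1 keeps the radius positive for \<open>C = 0\<close> and lets the open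
  ball contain values of norm equal to \<open>norm C\<close>.\<close>
proof (intro exI[of _ "norm C + 1"] exI[of _ "{0}"] conjI)
  show "blinfun_apply C ` cball 0 1 \<subseteq> (\<Union>y\<in>{0}. ball y (norm C + 1))"
  proof clarsimp
    fix x :: 'a assume "norm x \<le> 1"
    then have "norm C * norm x \<le> norm C"
      by (simp add: mult_left_le)
    then show "norm (C x) < norm C + 1"
      using norm_blinfun[of C x] by linarith
  qed
qed (simp_all add: add_nonneg_pos)

lemma q_norm_nonneg: "0 \<le> q_norm C"
  unfolding q_norm_def hausdorff_noncompactness_def
  using q_norm_cover_nonempty[of C] by (intro cInf_greatest) auto

text \<open>The infimum need not be attained, but some admissible radius lies below
  \<open>e\<close>, and its balls can be enlarged.\<close>

lemma q_norm_cover: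
  assumes "q_norm C < e"
  shows "\<exists>F. finite F \<and> blinfun_apply C ` cball 0 1 \<subseteq> (\<Union>y\<in>F. ball y e)"
proof -
  obtain d F where "d < e" "finite F" "blinfun_apply C ` cball 0 1 \<subseteq> (\<Union>y\<in>F. ball y d)"
    using assms q_norm_cover_nonempty[of C] unfolding q_norm_def hausdorff_noncompactness_def
    by (auto dest!: cInf_lessD[rotated])
  moreover have "(\<Union>y\<in>F. ball y d) \<subseteq> (\<Union>y\<in>F. ball y e)"
    using \<open>d < e\<close> by (intro UN_mono subset_ball) auto
  ultimately show ?thesis
    by (meson order_trans)
qed

lemma finite_cover_image_unit_ball:
  assumes "\<exists>F. finite F \<and> f ` cball 0 1 \<subseteq> (\<Union>y\<in>F. ball y e)"
    and "\<And>n. n \<in> N \<Longrightarrow> norm (u n) \<le> 1"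
  shows "\<exists>F. finite F \<and> (\<lambda>n. f (u n)) ` N \<subseteq> (\<Union>y\<in>F. ball y e)"
proof -
  have "(\<lambda>n. f (u n)) ` N \<subseteq> f ` cball 0 1"
    using assms(2) by auto
  then show ?thesis
    using assms(1) by (meson order_trans)
qed

lemma op_adjustment_le_q_norm:
  fixes C :: "'a::real_normed_vector \<Rightarrow>\<^sub>L 'b::real_normed_vector"
  shows "op_adjustment N (\<lambda>n. A) (\<lambda>n. op_plus A (bounded_op C)) \<le> q_norm C"
  unfolding op_adjustment_def
proof (rule adjustment_le, rule bounded_perturbation_lower_uniformly_adjusted(1)[OF q_norm_nonneg])
  fix \<eta> :: real and N' :: "nat set" and u :: "nat \<Rightarrow> 'a"
  assume "\<eta> > 0" and u: "\<And>n. n \<in> N' \<Longrightarrow> norm (u n) \<le> 1"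
  \<comment> \<open>The slack \<eta> in the notion of adjustment absorbs the possible non-attainment
    of the q-norm.\<close>
  then have "q_norm C < q_norm C + \<eta>"
    by simp
  from finite_cover_image_unit_ball[OF q_norm_cover[OF this] u]
  show "\<exists>F. finite F \<and> (\<lambda>n. C (u n)) ` N' \<subseteq> (\<Union>y\<in>F. ball y (q_norm C + \<eta>))" .
qed

section \<open>The gap inequality and the five perturbation results together\<close>

theorem theorem2p3p7:
  fixes N :: "nat set"
  assumes "infinite N"
  shows
    "(\<forall>(A :: nat \<Rightarrow> 'a::banach \<rightharpoonup> 'b::banach) B.
        (\<forall>n\<in>N. closed_operator (A n)) \<and> (\<forall>n\<in>N. closed_operator (B n)) \<longrightarrow>
        ereal (op_adjustment N A B) \<le> Limsup (along N) (\<lambda>n. ereal (op_gap (A n) (B n))))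
     \<and>
     (\<forall>(A :: 'a \<rightharpoonup> 'b) (C :: nat \<Rightarrow> 'a \<Rightarrow>\<^sub>L 'b).
        closed_operator A \<and> ((\<lambda>n. norm (C n)) \<longlongrightarrow> 0) (along N) \<longrightarrow>
        op_adjustment N (\<lambda>n. op_plus A (bounded_op (C n))) (\<lambda>n. A) = 0 \<and>
        op_adjustment N (\<lambda>n. A) (\<lambda>n. op_plus A (bounded_op (C n))) = 0)
     \<and>
     (\<forall>(A :: 'a \<rightharpoonup> 'b) (C :: 'a \<rightharpoonup> 'b).
        closed_operator A \<and> closed_operator C \<and> compact_relative_to A C \<longrightarrow>
        op_adjustment N (\<lambda>n. A) (\<lambda>n. op_plus A C) = 0)
     \<and>
     (\<forall>(A :: 'a \<rightharpoonup> 'b) (C :: 'a \<Rightarrow>\<^sub>L 'b).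
        closed_operator A \<longrightarrow>
        op_adjustment N (\<lambda>n. A) (\<lambda>n. op_plus A (bounded_op C)) \<le> q_norm C)
     \<and>
     (\<forall>(A :: 'a \<rightharpoonup> 'b) (C :: 'a \<Rightarrow>\<^sub>L 'b).
        closed_operator A \<and> compact_operator C \<longrightarrow>
        op_adjustment N (\<lambda>n. A) (\<lambda>n. op_plus A (bounded_op C)) = 0 \<and>
        op_adjustment N (\<lambda>n. op_plus A (bounded_op C)) (\<lambda>n. A) = 0)
     \<and>
     (\<forall>(A :: 'a \<rightharpoonup> 'b) (C :: nat \<Rightarrow> 'a \<Rightarrow>\<^sub>L 'b).
        closed_operator A \<and> K2_approximates_null N (\<lambda>n. bounded_op (C n)) \<longrightarrow>
        op_adjustment N (\<lambda>n. op_plus A (bounded_op (C n))) (\<lambda>n. A) = 0 \<and>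
        op_adjustment N (\<lambda>n. A) (\<lambda>n. op_plus A (bounded_op (C n))) = 0)"
proof (intro conjI allI impI)
  fix A B :: "nat \<Rightarrow> 'a \<rightharpoonup> 'b"
  assume "(\<forall>n\<in>N. closed_operator (A n)) \<and> (\<forall>n\<in>N. closed_operator (B n))"
  \<comment> \<open>Linearity makes the graphs subspaces; in particular the graph of
    \<open>B n\<close> contains 0.\<close>
  then show "ereal (op_adjustment N A B) \<le> Limsup (along N) (\<lambda>n. ereal (op_gap (A n) (B n)))"
    unfolding op_adjustment_def op_gap_def using \<open>infinite N\<close>
    by (intro adjustment_le_Limsup_gap)
      (auto simp: closed_operator_def subspace_op_graph intro: subspace_0)
next
  fix A :: "'a \<rightharpoonup> 'b" and C :: "nat \<Rightarrow> 'a \<Rightarrow>\<^sub>L 'b"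
  assume "closed_operator A \<and> ((\<lambda>n. norm (C n)) \<longlongrightarrow> 0) (along N)"
  note cover = finite_cover_null_sequence[OF conjunct2[OF this]]
  show "op_adjustment N (\<lambda>n. op_plus A (bounded_op (C n))) (\<lambda>n. A) = 0"
    and "op_adjustment N (\<lambda>n. A) (\<lambda>n. op_plus A (bounded_op (C n))) = 0"
    by (intro adjustment_bounded_perturbation_eq_0 cover; assumption)+
next
  fix A C :: "'a \<rightharpoonup> 'b"
  assume "closed_operator A \<and> closed_operator C \<and> compact_relative_to A C"
  then show "op_adjustment N (\<lambda>n. A) (\<lambda>n. op_plus A C) = 0"
    by (simp add: adjustment_relatively_compact_perturbation)
next
  fix A :: "'a \<rightharpoonup> 'b" and C :: "'a \<Rightarrow>\<^sub>L 'b"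
  show "op_adjustment N (\<lambda>n. A) (\<lambda>n. op_plus A (bounded_op C)) \<le> q_norm C"
    by (rule op_adjustment_le_q_norm)
next
  fix A :: "'a \<rightharpoonup> 'b" and C :: "'a \<Rightarrow>\<^sub>L 'b"
  assume "closed_operator A \<and> compact_operator C"
  \<comment> \<open>Covers of every radius are taken from compactness directly: the q-norm estimate
    treats only the direction from \<open>A\<close> to \<open>A + C\<close>, while both are claimed
    here.\<close>
  then have "\<exists>F. finite F \<and> blinfun_apply C ` cball 0 1 \<subseteq> (\<Union>y\<in>F. ball y \<eta>)" if "\<eta> > 0" for \<eta>
    using relatively_compact_imp_finite_cover that by (auto simp: compact_operator_def)
  note cover = finite_cover_image_unit_ball[OF this]
  show "op_adjustment N (\<lambda>n. A) (\<lambda>n. op_plus A (bounded_op C)) = 0"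
    and "op_adjustment N (\<lambda>n. op_plus A (bounded_op C)) (\<lambda>n. A) = 0"
    by (intro adjustment_bounded_perturbation_eq_0 cover; assumption)+
next
  fix A :: "'a \<rightharpoonup> 'b" and C :: "nat \<Rightarrow> 'a \<Rightarrow>\<^sub>L 'b"
  assume "closed_operator A \<and> K2_approximates_null N (\<lambda>n. bounded_op (C n))"
  note cover = finite_cover_K2_approximates_null[OF conjunct2[OF this]]
  show "op_adjustment N (\<lambda>n. op_plus A (bounded_op (C n))) (\<lambda>n. A) = 0"
    and "op_adjustment N (\<lambda>n. A) (\<lambda>n. op_plus A (bounded_op (C n))) = 0"
    by (intro adjustment_bounded_perturbation_eq_0 cover; assumption)+
qed

end
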